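(* Let $a<b$ be real numbers, let $q\in(0,1)$, and let $f:[a,b]\to\mathbb{R}$ be an arbitrary function. Then for all $x\in(a,b]$ and all integers $n\ge 0$, $$\left| f(x)-f\big(a+q^{n}(x-a)\big)\right| \le \left| x-\big(a+q^{n}(x-a)\big)\right|\,\left\| D_q^a f\right\|_\infty^{(a,b]}.$$
   Context: For $f:[a,b]\to\mathbb{R}$ and $q\in(0,1)$, the (shifted) $q$-derivative of $f$ at $x\in(a,b]$ is $$D_q^a f(x)=\frac{f(x)-f(a+q(x-a))}{(1-q)(x-a)},$$ which is defined for every function $f$ and every $x\in(a,b]$. For a function $g$ defined on $(a,b]$, $\|g\|_\infty^{(a,b]}=\sup_{t\in(a,b]}|g(t)|\in[0,+\infty]$. The supremum is allowed to be $+\infty$, in which case the inequality is understood in $[0,+\infty]$ with $0\cdot\infty=0$. *)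

theory Defs
  imports "HOL-Library.Extended_Nonnegative_Real"
begin

definition q_deriv :: "real \<Rightarrow> real \<Rightarrow> (real \<Rightarrow> real) \<Rightarrow> real \<Rightarrow> real" where
  "q_deriv q a f x = (f x - f (a + q * (x - a))) / ((1 - q) * (x - a))"

(* The supremum is taken in [0, \<infinity>], so it is \<top> for functions unbounded on A;
   multiplication in ennreal satisfies 0 * \<top> = 0. *)
definition sup_norm_on :: "real set \<Rightarrow> (real \<Rightarrow> real) \<Rightarrow> ennreal" where
  "sup_norm_on A g = (SUP t\<in>A. ennreal \<bar>g t\<bar>)"

end

theory Submission imports Defs begin

text \<open>Up to the factor \<open>(1 - q) * (y - a)\<close>, which is the distance from \<open>y\<close> to \<open>a + q * (y - a)\<close>, the
  \<open>q\<close>-derivative at \<open>y\<close> is the increment of \<open>f\<close> between these points. The increments along the orbit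
  \<open>a + q ^ n * (x - a)\<close> telescope, and so do the distances because the orbit is monotone.\<close>

lemma q_deriv_mult_eq:
  assumes "q \<noteq> 1" and "y \<noteq> a"
  shows "((1 - q) * (y - a)) * q_deriv q a f y = f y - f (a + q * (y - a))"
  using assms by (simp add: q_deriv_def)

lemma abs_le_sup_norm_on:
  assumes "t \<in> A"
  shows "ennreal \<bar>g t\<bar> \<le> sup_norm_on A g"
  unfolding sup_norm_on_def using assms by (rule SUP_upper)

text \<open>Passing to \<open>ennreal\<close> before bounding \<open>q_deriv\<close> by its supremum
  covers an infinite supremum without a case distinction.\<close>

lemma q_step_increment_le:
  assumes "q < 1" and "y \<in> {a<..b}"
  shows "ennreal \<bar>f y - f (a + q * (y - a))\<bar>
    \<le> ennreal ((1 - q) * (y - a)) * sup_norm_on {a<..b} (q_deriv q a f)"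
proof -
  have "f y - f (a + q * (y - a)) = ((1 - q) * (y - a)) * q_deriv q a f y"
    using assms by (intro q_deriv_mult_eq [symmetric]) auto
  moreover have "0 \<le> (1 - q) * (y - a)"
    using assms by simp
  ultimately have "ennreal \<bar>f y - f (a + q * (y - a))\<bar>
      = ennreal ((1 - q) * (y - a)) * ennreal \<bar>q_deriv q a f y\<bar>"
    \<comment> \<open>Instantiating \<open>abs_mult\<close> keeps the distance factor whole, so that
      \<open>abs_of_nonneg\<close> can drop its absolute value.\<close>
    by (simp only: abs_mult [of "(1 - q) * (y - a)"] abs_of_nonneg ennreal_mult abs_ge_zero)
  also have "\<dots> \<le> ennreal ((1 - q) * (y - a)) * sup_norm_on {a<..b} (q_deriv q a f)"
    using assms(2) by (intro mult_left_mono abs_le_sup_norm_on) auto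
  finally show ?thesis .
qed

text \<open>Keeps the orbit in the set over which the supremum is taken, so that the one-step bound
  applies at each of its points.\<close>

lemma q_orbit_mem:
  fixes a b q x :: real
  assumes "0 < q" and "q \<le> 1" and "x \<in> {a<..b}"
  shows "a + q ^ n * (x - a) \<in> {a<..b}"
proof -
  have "q ^ n * (x - a) \<le> 1 * (x - a)"
    using assms by (intro mult_right_mono power_le_one) auto
  moreover have "0 < q ^ n * (x - a)"
    using assms by simp
  ultimately show ?thesis
    using assms(3) unfolding greaterThanAtMost_iff by argo
qed

text \<open>The distance is written as a product without absolute value, so that the coefficients of
  successive steps simply add up in the induction.\<close>

lemma q_orbit_increment_le:
  assumes "0 < q" and "q < 1" and "x \<in> {a<..b}"
  shows "ennreal \<bar>f x - f (a + q ^ n * (x - a))\<bar>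
    \<le> ennreal ((1 - q ^ n) * (x - a)) * sup_norm_on {a<..b} (q_deriv q a f)"
proof (induction n)
  case 0
  then show ?case by simp
next
  case (Suc n)
  define y where "y = a + q ^ n * (x - a)"
  let ?N = "sup_norm_on {a<..b} (q_deriv q a f)"
  have y: "y \<in> {a<..b}"
    unfolding y_def using assms by (intro q_orbit_mem) auto
  have z: "a + q ^ Suc n * (x - a) = a + q * (y - a)"
    by (simp add: y_def)
  have "ennreal \<bar>f x - f (a + q ^ Suc n * (x - a))\<bar>
      \<le> ennreal (\<bar>f x - f y\<bar> + \<bar>f y - f (a + q * (y - a))\<bar>)"
    unfolding z by (intro ennreal_leI) simp
  also have "\<dots> = ennreal \<bar>f x - f y\<bar> + ennreal \<bar>f y - f (a + q * (y - a))\<bar>"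
    by simp
  also have "\<dots> \<le> ennreal ((1 - q ^ n) * (x - a)) * ?N + ennreal ((1 - q) * (y - a)) * ?N"
    using Suc.IH assms(2) y unfolding y_def by (intro add_mono q_step_increment_le)
  \<comment> \<open>Both coefficients are nonnegative, so \<open>ennreal\<close> is additive on
    them; distributivity holds even if \<open>?N\<close> is \<top>.\<close>
  also have "\<dots> = ennreal ((1 - q ^ n) * (x - a) + (1 - q) * (y - a)) * ?N"
    using assms y by (simp add: power_le_one ennreal_plus distrib_right)
  \<comment> \<open>Telescoping: the second summand is
    \<open>(q ^ n - q ^ Suc n) * (x - a)\<close>.\<close>
  also have "(1 - q ^ n) * (x - a) + (1 - q) * (y - a) = (1 - q ^ Suc n) * (x - a)"
    by (simp add: y_def algebra_simps)
  finally show ?case .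
qed

theorem theorem5:
  fixes a b q x :: real and f :: "real \<Rightarrow> real" and n :: nat
  assumes "a < b" and "0 < q" and "q < 1" and "x \<in> {a<..b}"
  shows "ennreal \<bar>f x - f (a + q ^ n * (x - a))\<bar>
    \<le> ennreal \<bar>x - (a + q ^ n * (x - a))\<bar> * sup_norm_on {a<..b} (q_deriv q a f)"
proof -
  have "0 \<le> (1 - q ^ n) * (x - a)"
    using assms by (simp add: power_le_one)
  moreover have "x - (a + q ^ n * (x - a)) = (1 - q ^ n) * (x - a)"
    by (simp add: algebra_simps)
  ultimately show ?thesis
    using q_orbit_increment_le [OF assms(2-4), of f n] by simp
qed

end
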